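(* $$\mathrm{m}\left(1-x^{1/6}+y+z\right)=\frac{2}{\pi}\int_0^{1/2}\frac{\sin^{-1}(u)}{u}\,du-\frac{12}{\pi^2}\mathrm{S}\left(\frac12,\frac12\right).$$
   Context: The fractional Mahler measure is defined by $\mathrm{m}(1-x^{1/6}+y+z)=\int_0^1\mathrm{m}\left(1-e^{2\pi iu/6}+y+z\right)du$, where for fixed $u$ the inner $\mathrm{m}$ is the two-variable Mahler measure in $y,z$: $\mathrm{m}(P(y,z))=\int_0^1\int_0^1\log|P(e^{2\pi i\theta_1},e^{2\pi i\theta_2})|\,d\theta_1d\theta_2$. The function $\mathrm{S}$ is $\mathrm{S}(v,w)=\int_0^1\frac{\sin^{-1}(vx)\sin^{-1}(wx)}{x}\,dx$. *)

theory Defs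
  imports "HOL-Analysis.Analysis"
begin

text \<open>
  Mahler measures are taken of the evaluation maps of polynomials. The logarithmic singularities
  of the integrand are absolutely integrable; that the library sets \<open>ln 0 = 0\<close> matters
  only on null sets of the torus, unless the polynomial is zero.
\<close>

definition mahler_measure2 :: "(complex \<Rightarrow> complex \<Rightarrow> complex) \<Rightarrow> real" where
  "mahler_measure2 P =
     (LBINT \<theta>2:{0..1}. (LBINT \<theta>1:{0..1}. ln (cmod (P (cis (2 * pi * \<theta>1)) (cis (2 * pi * \<theta>2))))))"

text \<open>
  \<open>frac_mahler_measure r P\<close> is the fractional Mahler measure of \<open>P(x\<^sup>r, y, z)\<close>: at
  \<open>x = exp(2 \<pi> i u)\<close> with \<open>0 \<le> u \<le> 1\<close>, the power \<open>x\<^sup>r\<close> is read as \<open>exp(2 \<pi> i u r)\<close>,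
  which is not the principal value for \<open>u > 1/2\<close>.
\<close>

definition frac_mahler_measure ::
    "real \<Rightarrow> (complex \<Rightarrow> complex \<Rightarrow> complex \<Rightarrow> complex) \<Rightarrow> real" where
  "frac_mahler_measure r P = (LBINT u:{0..1}. mahler_measure2 (P (cis (2 * pi * u * r))))"

definition S_fun :: "real \<Rightarrow> real \<Rightarrow> real" where
  "S_fun v w = (LBINT x:{0..1}. arcsin (v * x) * arcsin (w * x) / x)"

end

theory Submission
  imports Defs "HOL-Complex_Analysis.Cauchy_Integral_Formula"
begin

text \<open>
  By Jensen's formula the inner Mahler measure is the mean of \<open>ln\<^sup>+ \<bar>c + z\<bar>\<close> over the unit circle,
  with \<open>c = 1 - exp(\<pi>iu/3)\<close>; by rotation it depends only on \<open>a = \<bar>c\<bar> = 2 sin(\<pi>u/6)\<close>.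
  Writing \<open>ln\<^sup>+ \<bar>a + z\<bar>\<close> as the integral over \<open>t \<in> [0,a]\<close> of its radial derivative and
  exchanging the integrals, the angular integral becomes elementary (\<open>2 arcsin(t/2) / t\<close> on the half
  circle), so that the measure equals \<open>(2/\<pi>) \<integral> arcsin(s)/s ds\<close> over \<open>[0, sin(\<pi>u/6)]\<close>.
  Integrating this over \<open>u\<close> by parts, with \<open>arcsin(sin(\<pi>u/6)) = \<pi>u/6\<close>, yields both terms of the formula.
\<close>

text \<open>Countable sets are null. \<open>N\<close> collects the points where division by zero, or
  the limited range of an auxiliary formula, spoils agreement with a continuous function.\<close>

lemma set_lebesgue_integral_eq_integral_except_countable:
  fixes f g :: "real \<Rightarrow> real"
  assumes "continuous_on {a..b} g" and "countable N"
    and eq: "\<And>x. x \<in> {a..b} \<Longrightarrow> x \<notin> N \<Longrightarrow> f x = g x"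
  shows "(LBINT x:{a..b}. f x) = integral {a..b} g"
proof -
  have "(LBINT x:{a..b}. f x) = (LBINT x:{a..b}. g x)"
    unfolding set_lebesgue_integral_def
    by (rule integral_discrete_difference[where X=N])
       (use assms(2) eq in \<open>auto simp: indicator_def\<close>)
  also have "\<dots> = integral {a..b} g"
    by (intro set_borel_integral_eq_integral borel_integrable_atLeastAtMost' assms)
  finally show ?thesis .
qed

section \<open>Jensen's formula for linear polynomials\<close>

text \<open>The integrand is the real part of \<open>Ln (1 + v * z)\<close>, which is holomorphic on
  the closed disc because \<open>1 + v * z\<close> has positive real part there. Cauchy's formula at
  the centre gives the mean value \<open>Ln 1 = 0\<close>.\<close>

lemma integral_ln_cmod_cis_of_small:
  assumes "cmod v < 1"
  shows "integral {0..1} (\<lambda>\<theta>. ln (cmod (1 + v * cis (2 * pi * \<theta>)))) = 0"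
proof -
  have Re_pos: "Re (1 + v * z) > 0" if "cmod z \<le> 1" for z
  proof -
    have "cmod (v * z) \<le> cmod v * 1"
      unfolding norm_mult by (intro mult_left_mono that) auto
    with assms abs_Re_le_cmod[of "v * z"] show ?thesis by simp
  qed
  have "(\<lambda>z. Ln (1 + v * z)) holomorphic_on cball 0 1"
    using Re_pos by (intro holomorphic_intros) (force simp: complex_nonpos_Reals_iff not_le)
  from Cauchy_integral_circlepath_simple[OF this, of 0]
  have "((\<lambda>z. Ln (1 + v * z) / z) has_contour_integral 0) (circlepath 0 1)"
    by simp
  \<comment> \<open>The factor \<open>1 / z\<close> cancels against the derivative
    \<open>2 * pi * \<i> * z\<close> of the circle.\<close>
  then have "((\<lambda>\<theta>. 2 * pi * \<i> * Ln (1 + v * cis (2 * pi * \<theta>))) has_integral 0) {0..1}"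
    unfolding has_contour_integral_def
    by (rule has_integral_eq[rotated])
       (simp only: vector_derivative_circlepath01 atLeastAtMost_iff,
        simp add: circlepath cis_conv_exp mult_ac)
  from has_integral_mult_right[OF this, of "inverse (2 * pi * \<i>)"]
  have "((\<lambda>\<theta>. Ln (1 + v * cis (2 * pi * \<theta>))) has_integral 0) {0..1}"
    by (rule has_integral_eq[rotated, OF has_integral_eq_rhs]) (auto simp: field_simps)
  from has_integral_linear[OF this bounded_linear_Re]
  have "((\<lambda>\<theta>. ln (cmod (1 + v * cis (2 * pi * \<theta>)))) has_integral 0) {0..1}"
  proof (rule has_integral_eq[rotated, OF has_integral_eq_rhs])
    fix \<theta> :: real
    have "1 + v * cis (2 * pi * \<theta>) \<noteq> 0"
      using Re_pos[of "cis (2 * pi * \<theta>)"] by (metis less_irrefl norm_cis order_refl zero_complex.sel(1))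
    then show "(Re \<circ> (\<lambda>\<theta>. Ln (1 + v * cis (2 * pi * \<theta>)))) \<theta> = ln (cmod (1 + v * cis (2 * pi * \<theta>)))"
      by (simp add: Re_Ln)
  qed auto
  then show ?thesis by (rule integral_unique)
qed

text \<open>Jensen's formula: a small \<open>w\<close> is carried over to the previous lemma by
  conjugation, a large one is factored out. Modulus 1, which would put a zero on the circle, later
  occurs only for countably many angles.\<close>

lemma integral_ln_cmod_add_cis:
  assumes "cmod w \<noteq> 1"
  shows "(LBINT \<theta>:{0..1}. ln (cmod (w + cis (2 * pi * \<theta>)))) = ln (max 1 (cmod w))"
proof -
  have nz: "w + cis x \<noteq> 0" for x
    using assms by (metis add_eq_0_iff2 norm_cis norm_minus_cancel)
  then have "(LBINT \<theta>:{0..1}. ln (cmod (w + cis (2 * pi * \<theta>)))) =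
      integral {0..1} (\<lambda>\<theta>. ln (cmod (w + cis (2 * pi * \<theta>))))"
    by (intro set_lebesgue_integral_eq_integral_except_countable[where N="{}"] continuous_intros) auto
  also have "\<dots> = ln (max 1 (cmod w))"
  proof (cases "cmod w < 1")
    case True
    have "cmod (w + cis x) = cmod (1 + cnj w * cis x)" for x
    proof -
      \<comment> \<open>Since \<open>cis x * cnj (cis x) = 1\<close>, conjugation moves the
        coefficient \<open>w\<close> from the constant term to \<open>cis x\<close>.\<close>
      have "cmod (w + cis x) = cmod (cis x * cnj (1 + cnj w * cis x))"
        by (simp add: distrib_left cis_cnj mult.left_commute[of "cis x"] cis_mult add.commute)
      then show ?thesis by (simp only: norm_mult norm_cis complex_mod_cnj mult_1)
    qed
    then show ?thesis using True integral_ln_cmod_cis_of_small[of "cnj w"] by (simp add: max_def)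
  next
    case False
    with assms have w: "cmod w > 1" by simp
    then have w0: "w \<noteq> 0" by auto
    define v where "v = inverse w"
    have v: "cmod v < 1" using w by (simp add: v_def norm_inverse inverse_less_1_iff)
    have eq: "w + cis x = w * (1 + v * cis x)" for x
      using w0 by (simp add: v_def field_simps)
    then have nz': "1 + v * cis x \<noteq> 0" for x
      using nz by (metis mult_zero_right)
    have "integral {0..1} (\<lambda>\<theta>. ln (cmod (w + cis (2 * pi * \<theta>)))) =
        integral {0..1} (\<lambda>\<theta>. ln (cmod w) + ln (cmod (1 + v * cis (2 * pi * \<theta>))))"
      using nz' w0 by (simp add: eq norm_mult ln_mult)
    also have "\<dots> = integral {0..1} (\<lambda>\<theta>::real. ln (cmod w))
        + integral {0..1} (\<lambda>\<theta>. ln (cmod (1 + v * cis (2 * pi * \<theta>))))"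
      using nz' by (intro integral_add integrable_continuous_real continuous_intros) auto
    also have "\<dots> = ln (cmod w)"
      by (simp add: integral_ln_cmod_cis_of_small v)
    finally show ?thesis using w by (simp add: max_def)
  qed
  finally show ?thesis .
qed

section \<open>The continuous extension of arcsin(x)/x\<close>

text \<open>The value at 0 is the limit. Division by zero would give 0 there and break the
  continuity on which the fundamental theorem of calculus relies below.\<close>

definition arcsinc :: "real \<Rightarrow> real" where
  "arcsinc x = (if x = 0 then 1 else arcsin x / x)"

text \<open>At 0 the limit is the derivative of \<open>arcsin\<close>; elsewhere, endpoints
  included, continuity of \<open>arcsin\<close> suffices.\<close>

lemma continuous_on_arcsinc: "continuous_on {-1..1} arcsinc"
  unfolding continuous_on_eq_continuous_within
proof
  fix x :: real assume x: "x \<in> {-1..1}"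
  show "continuous (at x within {-1..1}) arcsinc"
  proof (cases "x = 0")
    case True
    have "((\<lambda>h. (arcsin (0 + h) - arcsin 0) / h) \<longlongrightarrow> 1) (at 0)"
      using DERIV_arcsin[of 0] by (simp add: DERIV_def)
    then have "(arcsinc \<longlongrightarrow> 1) (at 0)"
      by (rule Lim_transform_eventually) (auto simp: eventually_at_filter arcsinc_def)
    then show ?thesis
      using True by (auto simp: continuous_within arcsinc_def intro: tendsto_within_subset)
  next
    case False
    have "continuous_on {-1..1} arcsin" by (rule continuous_on_arcsin')
    then have "(arcsin \<longlongrightarrow> arcsin x) (at x within {-1..1})"
      using x by (auto simp: continuous_on_def)
    then have "((\<lambda>y. arcsin y / y) \<longlongrightarrow> arcsin x / x) (at x within {-1..1})"
      using False by (intro tendsto_intros)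
    moreover have "\<forall>\<^sub>F y in at x within {-1..1}. arcsin y / y = arcsinc y"
      using False t1_space_nhds[of x 0]
      by (auto simp: eventually_at_filter arcsinc_def elim: eventually_mono)
    ultimately have "(arcsinc \<longlongrightarrow> arcsin x / x) (at x within {-1..1})"
      by (rule Lim_transform_eventually)
    then show ?thesis using False by (simp add: continuous_within arcsinc_def)
  qed
qed

section \<open>The radial derivative and its integrals over angle and radius\<close>

text \<open>The integrand is the derivative in \<open>t\<close> of the logarithm of
  \<open>cmod (t + cis \<phi>)\<close>. The upper limit is the angle at which this modulus has
  decreased to 1.\<close>

lemma has_integral_truncated_kernel_angle:
  fixes t :: real
  assumes t: "0 < t" "t < 2"
  shows "((\<lambda>\<phi>. (t + cos \<phi>) / (1 + t\<^sup>2 + 2 * t * cos \<phi>)) has_integral 2 / t * arcsin (t / 2))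
    {0..arccos (- (t / 2))}"
proof -
  define \<phi>0 where "\<phi>0 = arccos (- (t / 2))"
  have cos0: "cos \<phi>0 = - (t / 2)" using t by (simp add: \<phi>0_def cos_arccos)
  have \<phi>0: "pi / 2 < \<phi>0" "\<phi>0 < pi"
    using t arccos_less_arccos[of "- (t/2)" 0] arccos_lt_bounded[of "- (t/2)"]
    by (auto simp: \<phi>0_def)
  \<comment> \<open>On this range \<open>cos \<phi> \<ge> - (t / 2)\<close>, so
    \<open>t + cis \<phi>\<close> stays in the right half-plane and its argument is an
    arctangent.\<close>
  have cos_ge: "t + cos \<phi> > 0" if "\<phi> \<in> {0..\<phi>0}" for \<phi>
    using cos_monotone_0_pi_le[of \<phi> \<phi>0] that \<phi>0 cos0 t by auto
  \<comment> \<open>The arctangent is the argument of \<open>t + cis \<phi>\<close>.\<close>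
  define P where "P \<phi> = (\<phi> - arctan (sin \<phi> / (t + cos \<phi>))) / t" for \<phi>
  have "((\<lambda>\<phi>. (t + cos \<phi>) / (1 + t\<^sup>2 + 2 * t * cos \<phi>)) has_integral P \<phi>0 - P 0) {0..\<phi>0}"
  proof (rule fundamental_theorem_of_calculus)
    fix \<phi> assume \<phi>: "\<phi> \<in> {0..\<phi>0}"
    define c s where "c = cos \<phi>" and "s = sin \<phi>"
    have tc: "t + c > 0" using cos_ge[OF \<phi>] by (simp add: c_def)
    have sc: "s\<^sup>2 = 1 - c\<^sup>2" unfolding c_def s_def by (rule sin_squared_eq)
    have N: "(t + c)\<^sup>2 + s\<^sup>2 = 1 + t\<^sup>2 + 2 * t * c"
      unfolding sc by (simp add: power2_eq_square algebra_simps)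
    have N0: "1 + t\<^sup>2 + 2 * t * c > 0"
      unfolding N[symmetric] using tc by (simp add: add_pos_nonneg)
    have "(P has_real_derivative
        (1 - ((c * (t + c) - s * (- s)) / ((t + c) * (t + c))) / (1 + (s / (t + c))\<^sup>2)) / t) (at \<phi>)"
      unfolding P_def using tc t
      by (auto intro!: derivative_eq_intros simp: c_def s_def field_simps)
    also have "((c * (t + c) - s * (- s)) / ((t + c) * (t + c))) / (1 + (s / (t + c))\<^sup>2)
       = (c * (t + c) + s\<^sup>2) / ((t + c)\<^sup>2 + s\<^sup>2)"
    proof -
      have "1 + (s / (t + c))\<^sup>2 = ((t + c)\<^sup>2 + s\<^sup>2) / (t + c)\<^sup>2"
        using tc by (simp add: power_divide add_divide_distrib)
      then show ?thesis using tc by (simp add: power2_eq_square)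
    qed
    also have "\<dots> = (1 + t * c) / (1 + t\<^sup>2 + 2 * t * c)"
      unfolding N unfolding sc by (simp add: power2_eq_square algebra_simps)
    also have "(1 - (1 + t * c) / (1 + t\<^sup>2 + 2 * t * c)) / t = (t + c) / (1 + t\<^sup>2 + 2 * t * c)"
    proof -
      have "1 - (1 + t * c) / (1 + t\<^sup>2 + 2 * t * c) = (t * (t + c)) / (1 + t\<^sup>2 + 2 * t * c)"
        using N0 by (simp add: diff_eq_eq flip: add_divide_distrib)
          (simp add: power2_eq_square algebra_simps)
      then show ?thesis using t by simp
    qed
    finally show "(P has_vector_derivative (t + cos \<phi>) / (1 + t\<^sup>2 + 2 * t * cos \<phi>)) (at \<phi> within {0..\<phi>0})"
      unfolding c_def by (metis has_real_derivative_iff_has_vector_derivative has_vector_derivative_at_within)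
  qed (use \<phi>0 in auto)
  also have "P \<phi>0 - P 0 = 2 / t * arcsin (t / 2)"
  proof -
    \<comment> \<open>Here \<open>t + cos \<phi>0 = t / 2 = - cos \<phi>0\<close>: the point
      \<open>t + cis \<phi>0\<close> is the mirror image of \<open>cis \<phi>0\<close> in the
      imaginary axis.\<close>
    have "arctan (sin \<phi>0 / (t + cos \<phi>0)) = pi - \<phi>0"
    proof (rule arctan_unique)
      show "tan (pi - \<phi>0) = sin \<phi>0 / (t + cos \<phi>0)"
        using t by (simp add: tan_def cos_diff sin_diff cos0)
    qed (use \<phi>0 in auto)
    moreover have "\<phi>0 = pi - arccos (t / 2)" using t by (simp add: \<phi>0_def arccos_minus)
    moreover have "arcsin (t / 2) = pi / 2 - arccos (t / 2)"
      using t by (simp add: arcsin_arccos_eq)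
    ultimately show ?thesis using t unfolding P_def by (simp only:) (simp add: field_simps)
  qed
  finally show ?thesis unfolding \<phi>0_def .
qed

lemma cmod_add_cis: "cmod (complex_of_real t + cis \<phi>) = sqrt (1 + t\<^sup>2 + 2 * t * cos \<phi>)"
proof -
  have "(t + cos \<phi>)\<^sup>2 + (sin \<phi>)\<^sup>2 = 1 + t\<^sup>2 + 2 * t * cos \<phi>"
    unfolding sin_squared_eq by (simp add: power2_eq_square algebra_simps)
  then show ?thesis by (simp add: cmod_def)
qed

text \<open>The derivative in \<open>t\<close> of \<open>ln\<^sup>+ \<bar>t + cis \<phi>\<bar>\<close>: for \<open>t > 0\<close>, the modulus exceeds 1 iff \<open>t + 2 cos \<phi> > 0\<close>.\<close>
definition truncated_kernel :: "real \<Rightarrow> real \<Rightarrow> real" where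
  "truncated_kernel t \<phi> =
     (if t + 2 * cos \<phi> > 0 then (t + cos \<phi>) / (1 + t\<^sup>2 + 2 * t * cos \<phi>) else 0)"

text \<open>The kernel is at most the inverse of the modulus of \<open>t + cis \<phi>\<close>, and
  the truncation keeps that modulus at least 1. This bound gives the integrability needed for
  Fubini.\<close>

lemma abs_truncated_kernel_le:
  assumes "t \<ge> 0"
  shows "\<bar>truncated_kernel t \<phi>\<bar> \<le> 1"
proof (cases "t + 2 * cos \<phi> > 0")
  case True
  define M where "M = 1 + t\<^sup>2 + 2 * t * cos \<phi>"
  have "t * (t + 2 * cos \<phi>) \<ge> 0" using True assms by simp
  then have M1: "M \<ge> 1" by (simp add: M_def power2_eq_square algebra_simps)
  have "(t + cos \<phi>)\<^sup>2 = M - (sin \<phi>)\<^sup>2"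
    unfolding M_def sin_squared_eq by (simp add: power2_eq_square algebra_simps)
  also have "\<dots> \<le> M * 1" by simp
  also have "\<dots> \<le> M\<^sup>2" unfolding power2_eq_square using M1 by (intro mult_left_mono) auto
  finally have "\<bar>t + cos \<phi>\<bar> \<le> M" using M1 by (simp add: abs_le_square_iff[symmetric])
  then show ?thesis using M1 True by (simp add: truncated_kernel_def flip: M_def)
qed (simp add: truncated_kernel_def)

lemma measurable_truncated_kernel [measurable]:
  "case_prod truncated_kernel \<in> borel_measurable (lborel \<Otimes>\<^sub>M lborel)"
  unfolding truncated_kernel_def by measurable

text \<open>Fundamental theorem of calculus for a primitive that vanishes at 0. The only possible
  kink is at \<open>t = - 2 * cos \<phi>\<close>, where \<open>t + cis \<phi>\<close> crosses the
  unit circle.\<close>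

lemma has_integral_truncated_kernel_radius:
  assumes "a > 0"
  shows "((\<lambda>t. truncated_kernel t \<phi>) has_integral ln (max 1 (cmod (complex_of_real a + cis \<phi>)))) {0..a}"
proof -
  define L where "L t = ln (max 1 (cmod (complex_of_real t + cis \<phi>)))" for t
  have "((\<lambda>t. truncated_kernel t \<phi>) has_integral L a - L 0) {0..a}"
  proof (rule fundamental_theorem_of_calculus_interior_strong[where S="{- 2 * cos \<phi>}"])
    show "continuous_on {0..a} L" unfolding L_def
      by (intro continuous_intros) auto
    fix t assume t: "t \<in> {0<..<a} - {- 2 * cos \<phi>}"
    define M where "M s = 1 + s\<^sup>2 + 2 * s * cos \<phi>" for s
    have M_eq: "M s = 1 + s * (s + 2 * cos \<phi>)" for s
      by (simp add: M_def power2_eq_square algebra_simps)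
    show "(L has_vector_derivative truncated_kernel t \<phi>) (at t)"
    proof (cases "t > - 2 * cos \<phi>")
      case True
      have M1: "M s > 1" if "s > max 0 (- 2 * cos \<phi>)" for s
        using that by (simp add: M_eq)
      have eq: "L s = ln (M s) / 2" if "s \<in> {max 0 (- 2 * cos \<phi>)<..}" for s
        using M1[of s] that unfolding L_def cmod_add_cis
        by (simp add: max_def ln_sqrt flip: M_def)
      have "((\<lambda>s. ln (M s) / 2) has_real_derivative (t + cos \<phi>) / M t) (at t)"
        using M1[of t] t True unfolding M_def
        by (auto intro!: derivative_eq_intros simp: field_simps)
      then have "(L has_real_derivative (t + cos \<phi>) / M t) (at t)"
        by (rule DERIV_cong_ev[THEN iffD2, rotated -1, OF _ refl _ refl])
          (use eq t True in \<open>auto intro!: eventually_mono[OF eventually_nhds_in_open[of "{max 0 (- 2 * cos \<phi>)<..}"]]\<close>)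
      then show ?thesis using True
        by (simp add: truncated_kernel_def M_def has_real_derivative_iff_has_vector_derivative)
    next
      case False
      with t have "t < - 2 * cos \<phi>" by auto
      have eq: "L s = 0" if "s \<in> {0<..<- 2 * cos \<phi>}" for s
      proof -
        have "M s \<le> 1" using that by (simp add: M_eq mult_nonneg_nonpos)
        then show ?thesis unfolding L_def cmod_add_cis
          by (simp add: max_def flip: M_def)
      qed
      have "(L has_real_derivative 0) (at t)"
        by (rule DERIV_cong_ev[THEN iffD2, rotated -1, OF DERIV_const refl _ refl])
          (use eq t False in \<open>auto intro!: eventually_mono[OF eventually_nhds_in_open[of "{0<..<- 2 * cos \<phi>}"]]\<close>)
      then show ?thesis using False
        by (simp add: truncated_kernel_def has_real_derivative_iff_has_vector_derivative)
    qed
  qed (use assms in auto)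
  then show ?thesis by (simp add: L_def)
qed

text \<open>As \<open>cos\<close> decreases on \<open>{0..pi}\<close>, the truncation cuts the angle
  off at \<open>arccos (- (t / 2))\<close>; only the value at that endpoint has to be
  disregarded.\<close>

lemma has_integral_truncated_kernel_angle':
  assumes t: "0 < t" "t < 2"
  shows "(truncated_kernel t has_integral arcsinc (t / 2)) {0..pi}"
proof -
  define \<phi>0 where "\<phi>0 = arccos (- (t / 2))"
  have cos0: "cos \<phi>0 = - (t / 2)" using t by (simp add: \<phi>0_def cos_arccos)
  have \<phi>0: "0 \<le> \<phi>0" "\<phi>0 \<le> pi"
    using t by (auto simp: \<phi>0_def arccos_lbound arccos_ubound)
  let ?g = "\<lambda>\<phi>. (t + cos \<phi>) / (1 + t\<^sup>2 + 2 * t * cos \<phi>)"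
  have "((\<lambda>\<phi>. if \<phi> \<in> {0..\<phi>0} then ?g \<phi> else 0) has_integral 2 / t * arcsin (t / 2)) {0..pi}"
    using has_integral_truncated_kernel_angle[OF t] \<phi>0
    by (subst has_integral_restrict) (auto simp: \<phi>0_def)
  then have "(truncated_kernel t has_integral 2 / t * arcsin (t / 2)) {0..pi}"
  proof (rule has_integral_spike_finite[where S="{\<phi>0}", rotated 2])
    fix \<phi> assume \<phi>: "\<phi> \<in> {0..pi} - {\<phi>0}"
    have "cos \<phi> > - (t / 2) \<longleftrightarrow> \<phi> \<in> {0..\<phi>0}"
      using \<phi> \<phi>0 cos_mono_less_eq[of \<phi>0 \<phi>] cos0 by auto
    then show "truncated_kernel t \<phi> = (if \<phi> \<in> {0..\<phi>0} then ?g \<phi> else 0)"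
      by (auto simp: truncated_kernel_def)
  qed simp
  then show ?thesis using t by (simp add: arcsinc_def mult.commute)
qed

section \<open>Exchange of the radial and angular integrals\<close>

lemma set_integrable_lborel_bounded:
  fixes f :: "real \<Rightarrow> real"
  assumes "f \<in> borel_measurable borel" "\<And>x. x \<in> {a..b} \<Longrightarrow> \<bar>f x\<bar> \<le> B"
  shows "set_integrable lborel {a..b} f"
  unfolding set_integrable_def
  by (rule integrableI_bounded_set_indicator[where B=B])
    (use assms in \<open>auto simp: emeasure_lborel_Icc_eq\<close>)

lemma integral_halve:
  fixes f :: "real \<Rightarrow> real"
  assumes "continuous_on {0..b} f"
  shows "integral {0..2 * b} (\<lambda>x. f (x / 2)) = 2 * integral {0..b} f"
proof -
  have "(f has_integral integral {0..b} f) (cbox 0 b)"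
    using assms by (simp add: integrable_continuous_real integrable_integral)
  from has_integral_affinity'[OF this, of "1/2" 0] show ?thesis
    by (intro integral_unique) (simp add: mult.commute)
qed

text \<open>Fubini for the kernel on \<open>{0..a} \<times> {0..pi}\<close>: integrating first over
  the radius gives the left side, integrating first over the angle gives
  \<open>arcsinc (t / 2)\<close>, and \<open>s = t / 2\<close> accounts for the factor 2.\<close>

lemma integral_ln_max_cmod_add_cis:
  assumes a: "0 < a" "a < 2"
  shows "integral {0..pi} (\<lambda>\<phi>. ln (max 1 (cmod (complex_of_real a + cis \<phi>)))) =
    2 * integral {0..a / 2} arcsinc"
proof -
  define f :: "real \<Rightarrow> real \<Rightarrow> real" where
    "f t \<phi> = indicator {0..a} t * (indicator {0..pi} \<phi> * truncated_kernel t \<phi>)" for t \<phi>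
  have "integrable (lborel \<Otimes>\<^sub>M lborel) (case_prod f)"
  proof (rule integrableI_bounded_set[where A="{0..a} \<times> {0..pi}" and B=1])
    show "case_prod f \<in> borel_measurable (lborel \<Otimes>\<^sub>M lborel)"
      unfolding f_def by measurable
    show "emeasure (lborel \<Otimes>\<^sub>M lborel) ({0..a} \<times> {0..pi}) < \<infinity>"
      by (subst lborel.emeasure_pair_measure_Times) (use a in \<open>auto simp: ennreal_mult_less_top emeasure_lborel_Icc_eq\<close>)
  qed (auto simp: f_def indicator_def abs_truncated_kernel_le)
  from lborel_pair.Fubini_integral[OF this]
  have fub: "(\<integral>\<phi>. (\<integral>t. f t \<phi> \<partial>lborel) \<partial>lborel) = (\<integral>t. (\<integral>\<phi>. f t \<phi> \<partial>lborel) \<partial>lborel)" .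
  have "(LBINT t:{0..a}. truncated_kernel t \<phi>) = ln (max 1 (cmod (complex_of_real a + cis \<phi>)))" for \<phi>
  proof -
    have "set_integrable lborel {0..a} (\<lambda>t. truncated_kernel t \<phi>)"
      by (rule set_integrable_lborel_bounded[where B=1]) (auto simp: abs_truncated_kernel_le)
    then show ?thesis
      using has_integral_truncated_kernel_radius[OF a(1)]
      by (simp add: set_borel_integral_eq_integral integral_unique)
  qed
  then have "(\<integral>\<phi>. (\<integral>t. f t \<phi> \<partial>lborel) \<partial>lborel) =
      (LBINT \<phi>:{0..pi}. ln (max 1 (cmod (complex_of_real a + cis \<phi>))))"
    by (simp add: f_def set_lebesgue_integral_def mult.left_commute[of "indicator {0..a} _"])
  also have "\<dots> = integral {0..pi} (\<lambda>\<phi>. ln (max 1 (cmod (complex_of_real a + cis \<phi>))))"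
    by (rule set_lebesgue_integral_eq_integral_except_countable[where N="{}"])
      (auto intro!: continuous_intros)
  finally have lhs: "(\<integral>\<phi>. (\<integral>t. f t \<phi> \<partial>lborel) \<partial>lborel) = \<dots>" .
  have "(\<integral>t. (\<integral>\<phi>. f t \<phi> \<partial>lborel) \<partial>lborel) = (LBINT t:{0..a}. (LBINT \<phi>:{0..pi}. truncated_kernel t \<phi>))"
    by (simp add: f_def set_lebesgue_integral_def)
  \<comment> \<open>The radius \<open>t = 0\<close> is excepted because the angular formula was
    derived by dividing by \<open>t\<close>.\<close>
  also have "\<dots> = integral {0..a} (\<lambda>t. arcsinc (t / 2))"
  proof (rule set_lebesgue_integral_eq_integral_except_countable[where N="{0}"])
    show "continuous_on {0..a} (\<lambda>t. arcsinc (t / 2))"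
      by (rule continuous_on_compose2[OF continuous_on_arcsinc]) (use a in \<open>auto intro!: continuous_intros\<close>)
    fix t assume t: "t \<in> {0..a}" "t \<notin> {0}"
    have "set_integrable lborel {0..pi} (truncated_kernel t)"
      by (rule set_integrable_lborel_bounded[where B=1]) (use t in \<open>auto simp: abs_truncated_kernel_le\<close>)
    then show "(LBINT \<phi>:{0..pi}. truncated_kernel t \<phi>) = arcsinc (t / 2)"
      using has_integral_truncated_kernel_angle'[of t] a t
      by (simp add: set_borel_integral_eq_integral integral_unique)
  qed auto
  also have "\<dots> = 2 * integral {0..a / 2} arcsinc"
    using integral_halve[of "a / 2" arcsinc] a
    by (simp add: continuous_on_subset[OF continuous_on_arcsinc])
  finally show ?thesis using lhs fub by simp
qed

section \<open>The inner Mahler measure\<close>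

text \<open>The integral over a full period does not depend on the starting point \<open>c\<close>,
  and evenness folds it to twice the half period. The substitution contributes
  \<open>1 / (2 * pi)\<close>.\<close>

lemma integral_periodic_even:
  fixes g :: "real \<Rightarrow> real"
  assumes cont: "continuous_on UNIV g" and per: "\<And>x. g (x + 2 * pi) = g x"
    and even: "\<And>x. g (- x) = g x" and c: "0 \<le> c" "c \<le> 2 * pi"
  shows "integral {0..1} (\<lambda>x. g (2 * pi * x + c)) = integral {0..pi} g / pi"
proof -
  have int: "g integrable_on {x..y}" for x y
    by (intro integrable_continuous_real continuous_on_subset[OF cont]) auto
  have shift: "integral {x + 2 * pi..y + 2 * pi} g = integral {x..y} g" for x y
  proof -
    have "(g has_integral integral {x + 2 * pi..y + 2 * pi} g) (cbox (x + 2 * pi) (y + 2 * pi))"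
      using int by (simp add: integrable_integral)
    from has_integral_affinity'[OF this, of 1 "2 * pi"]
    have "(g has_integral integral {x + 2 * pi..y + 2 * pi} g) {x..y}"
      by (simp add: per)
    from integral_unique[OF this] show ?thesis by (rule sym)
  qed
  have "integral {c..c + 2 * pi} g = integral {c..2 * pi} g + integral {2 * pi..c + 2 * pi} g"
    using c by (intro Henstock_Kurzweil_Integration.integral_combine[symmetric] int) auto
  also have "integral {2 * pi..c + 2 * pi} g = integral {0..c} g"
    using shift[of 0 c] by (simp only: add_0)
  also have "integral {c..2 * pi} g + integral {0..c} g = integral {0..2 * pi} g"
    using Henstock_Kurzweil_Integration.integral_combine[OF c int] by (simp only: add.commute)
  also have "\<dots> = integral {0..pi} g + integral {pi..2 * pi} g"
    by (intro Henstock_Kurzweil_Integration.integral_combine[symmetric] int) auto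
  \<comment> \<open>A shift by one period; the upper limit is written as the reflection of 0 in
    preparation for the next step.\<close>
  also have "integral {pi..2 * pi} g = integral {- pi..- 0} g"
  proof -
    have "- pi + 2 * pi = pi" "0 + 2 * pi = 2 * pi" "- (0::real) = 0" by simp_all
    with shift[of "- pi" 0] show ?thesis by (simp only:)
  qed
  also have "\<dots> = integral {0..pi} g"
    using Henstock_Kurzweil_Integration.integral_reflect_real[of pi 0 g] by (simp only: even)
  finally have full: "integral {c..c + 2 * pi} g = 2 * integral {0..pi} g" by linarith
  have "(g has_integral integral {c..c + 2 * pi} g) (cbox c (c + 2 * pi))"
    using integrable_integral[OF int] by (simp only: cbox_interval)
  from has_integral_affinity'[OF this, of "2 * pi" c]
  have "((\<lambda>x. g (2 * pi * x + c)) has_integral integral {c..c + 2 * pi} g / (2 * pi)) {0..1}"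
    unfolding full by (simp, simp only: divide_inverse_commute)
  from integral_unique[OF this] show ?thesis by (simp add: full)
qed

text \<open>Serves to show that the angles at which Jensen's formula would meet modulus 1 are
  negligible.\<close>

lemma countable_cos_eq: "countable {x::real. cos x = d}"
proof (rule countable_subset)
  show "{x. cos x = d} \<subseteq> range (\<lambda>k::int. arccos d + 2 * k * pi) \<union> range (\<lambda>k::int. - arccos d + 2 * k * pi)"
    by (auto simp: cos_eq_arccos_Ex)
qed auto

text \<open>Jensen's formula handles \<open>y\<close>, and a rotation by \<open>\<beta>\<close> in
  \<open>z\<close> makes the constant real. The range of \<open>\<beta>\<close> places the shift
  \<open>- \<beta>\<close> within one period.\<close>

lemma mahler_measure2_const_add_add:
  assumes a: "0 < a" "a < 2" and \<beta>: "- (2 * pi) \<le> \<beta>" "\<beta> \<le> 0"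
  shows "mahler_measure2 (\<lambda>y z. complex_of_real a * cis \<beta> + y + z) = 2 / pi * integral {0..a / 2} arcsinc"
proof -
  let ?c = "complex_of_real a * cis \<beta>"
  let ?g = "\<lambda>\<phi>. ln (max 1 (cmod (complex_of_real a + cis \<phi>)))"
  have rot: "cmod (?c + cis x) = cmod (complex_of_real a + cis (x - \<beta>))" for x
  proof -
    have "?c + cis x = cis \<beta> * (complex_of_real a + cis (x - \<beta>))"
      by (simp add: algebra_simps cis_mult)
    then show ?thesis by (simp add: norm_mult)
  qed
  \<comment> \<open>By the law of cosines, \<open>cmod (a + cis x) = 1\<close> means
    \<open>a * (a + 2 * cos x) = 0\<close>; the map recovers \<theta> from
    \<open>x = 2 * pi * \<theta> - \<beta>\<close>.\<close>
  let ?N = "(\<lambda>x. (x + \<beta>) / (2 * pi)) ` {x. cos x = - a / 2}"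
  have "mahler_measure2 (\<lambda>y z. ?c + y + z) = integral {0..1} (\<lambda>\<theta>. ?g (2 * pi * \<theta> + (- \<beta>)))"
    unfolding mahler_measure2_def
  proof (rule set_lebesgue_integral_eq_integral_except_countable[where N="?N"])
    show "continuous_on {0..1} (\<lambda>\<theta>. ?g (2 * pi * \<theta> + (- \<beta>)))"
      by (intro continuous_intros) auto
    show "countable ?N" by (intro countable_image countable_cos_eq)
    fix \<theta> :: real assume \<theta>: "\<theta> \<notin> ?N"
    have "cmod (?c + cis (2 * pi * \<theta>)) \<noteq> 1"
    proof
      assume "cmod (?c + cis (2 * pi * \<theta>)) = 1"
      then have "a * (a + 2 * cos (2 * pi * \<theta> - \<beta>)) = 0"
        unfolding rot cmod_add_cis by (simp add: power2_eq_square algebra_simps)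
      then have "cos (2 * pi * \<theta> - \<beta>) = - a / 2" using a by simp
      then have "\<theta> \<in> ?N" by (intro image_eqI[where x="2 * pi * \<theta> - \<beta>"]) auto
      with \<theta> show False by simp
    qed
    from integral_ln_cmod_add_cis[OF this]
    show "(LBINT \<theta>1:{0..1}. ln (cmod (?c + cis (2 * pi * \<theta>1) + cis (2 * pi * \<theta>)))) = ?g (2 * pi * \<theta> + (- \<beta>))"
      by (simp add: rot add_ac)
  qed
  also have "\<dots> = integral {0..pi} ?g / pi"
    by (rule integral_periodic_even) (use \<beta> in \<open>auto intro!: continuous_intros simp: cmod_add_cis\<close>)
  also have "\<dots> = 2 / pi * integral {0..a / 2} arcsinc"
    by (simp add: integral_ln_max_cmod_add_cis a)
  finally show ?thesis .
qed

section \<open>Integration over u\<close>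

text \<open>For \<open>sin x > 0\<close> this is the polar form demanded by the inner Mahler
  measure.\<close>

lemma one_minus_cis_double:
  "1 - cis (2 * x) = complex_of_real (2 * sin x) * cis (x - pi / 2)"
  by (rule complex_eqI) (simp_all add: cos_double_sin sin_double cos_diff sin_diff power2_eq_square)

lemma has_integral_integral_arcsinc_sin:
  "((\<lambda>u. integral {0..sin (pi * u / 6)} arcsinc) has_integral
     integral {0..1/2} arcsinc - 6 / pi * integral {0..1/2} (\<lambda>s. arcsin s * arcsinc s)) {0..1}"
proof -
  let ?B = "\<lambda>s. arcsin s * arcsinc s"
  define A B where "A x = integral {0..x} arcsinc" and "B x = integral {0..x} ?B" for x
  \<comment> \<open>Integration by parts: with \<open>s = sin (pi * u / 6)\<close> one has
    \<open>u = 6 / pi * arcsin s\<close>, so the term \<open>u\<close> times the derivative of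
    \<open>A s\<close> is \<open>6 / pi\<close> times the derivative of \<open>B s\<close>.\<close>
  define H where "H u = u * A (sin (pi * u / 6)) - 6 / pi * B (sin (pi * u / 6))" for u
  have cA: "continuous_on {0..1} arcsinc"
    by (rule continuous_on_subset[OF continuous_on_arcsinc]) auto
  have cB: "continuous_on {0..1} ?B"
    by (intro continuous_intros cA) auto
  \<comment> \<open>The derivatives are taken within \<open>{0..1}\<close>, hence one-sided at its
    ends; the chain rule below therefore needs the sine to map \<open>{0..1}\<close> into
    itself.\<close>
  have A': "(A has_real_derivative arcsinc x) (at x within {0..1})" if "x \<in> {0..1}" for x
    unfolding A_def using integral_has_real_derivative[OF cA that] .
  have B': "(B has_real_derivative arcsin x * arcsinc x) (at x within {0..1})" if "x \<in> {0..1}" for x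
    unfolding B_def using integral_has_real_derivative[OF cB that] .
  have sin01: "sin (pi * u / 6) \<in> {0..1}" if "u \<in> {0..1}" for u
    using that by (auto intro!: sin_ge_zero mult_left_le simp: field_simps)
  have "((\<lambda>u. A (sin (pi * u / 6))) has_integral H 1 - H 0) {0..1}"
  proof (rule fundamental_theorem_of_calculus)
    fix u :: real assume u: "u \<in> {0..1}"
    let ?s = "\<lambda>u. sin (pi * u / 6)"
    have s': "(?s has_real_derivative cos (pi * u / 6) * (pi / 6)) (at u within {0..1})"
      by (auto intro!: derivative_eq_intros)
    have img: "?s ` {0..1} \<subseteq> {0..1}" using sin01 by blast
    have dA: "((\<lambda>u. A (?s u)) has_real_derivative arcsinc (?s u) * (cos (pi * u / 6) * (pi / 6))) (at u within {0..1})"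
      using DERIV_image_chain[OF DERIV_subset[OF A'[OF sin01[OF u]] img] s']
      by (simp add: o_def)
    have dB: "((\<lambda>u. B (?s u)) has_real_derivative arcsin (?s u) * arcsinc (?s u) * (cos (pi * u / 6) * (pi / 6))) (at u within {0..1})"
      using DERIV_image_chain[OF DERIV_subset[OF B'[OF sin01[OF u]] img] s']
      by (simp add: o_def)
    have "0 \<le> pi * u" "pi * u \<le> pi * 1"
      using u by (intro mult_nonneg_nonneg mult_left_mono; simp)+
    then have arcsin_s: "arcsin (?s u) = pi * u / 6"
      using pi_gt_zero by (intro arcsin_sin; linarith)
    have "(H has_real_derivative A (?s u)) (at u within {0..1})"
      unfolding H_def
      by (intro DERIV_cong[OF DERIV_diff[OF DERIV_mult[OF DERIV_ident dA] DERIV_cmult[OF dB]]])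
        (simp only: arcsin_s, simp)
    then show "(H has_vector_derivative A (?s u)) (at u within {0..1})"
      by (simp add: has_real_derivative_iff_has_vector_derivative)
  qed simp
  moreover have "H 1 - H 0 = A (1/2) - 6 / pi * B (1/2)"
    by (simp add: H_def B_def sin_30)
  ultimately show ?thesis by (simp add: A_def B_def)
qed

theorem mainTheorem7:
  "frac_mahler_measure (1 / 6) (\<lambda>x y z. 1 - x + y + z) =
     2 / pi * (LBINT u:{0..1/2}. arcsin u / u) - 12 / pi\<^sup>2 * S_fun (1 / 2) (1 / 2)"
proof -
  let ?A = "\<lambda>u. integral {0..sin (pi * u / 6)} arcsinc"
  have c: "continuous_on {0..1/2} arcsinc"
    by (rule continuous_on_subset[OF continuous_on_arcsinc]) auto
  have cS: "continuous_on {0..1/2} (\<lambda>s. arcsin s * arcsinc s)"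
    by (intro continuous_intros c) auto
  \<comment> \<open>At \<open>u = 0\<close> the constant \<open>1 - cis 0\<close> vanishes and has
    no polar form with \<open>a > 0\<close>, so this point is excepted.\<close>
  have "frac_mahler_measure (1 / 6) (\<lambda>x y z. 1 - x + y + z) = integral {0..1} (\<lambda>u. 2 / pi * ?A u)"
    unfolding frac_mahler_measure_def
  proof (rule set_lebesgue_integral_eq_integral_except_countable[where N="{0}"])
    have "continuous_on {0..1} (\<lambda>x. integral {0..x} arcsinc)"
      by (intro indefinite_integral_continuous_1 integrable_continuous_real
            continuous_on_subset[OF continuous_on_arcsinc]) auto
    then have "continuous_on {0..1} ?A"
      by (rule continuous_on_compose2) (auto intro!: continuous_intros sin_ge_zero simp: field_simps)
    then show "continuous_on {0..1} (\<lambda>u. 2 / pi * ?A u)"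
      by (intro continuous_intros)
    fix u :: real assume u: "u \<in> {0..1}" "u \<notin> {0}"
    define x where "x = pi * u / 6"
    have x: "0 < x" "x \<le> pi / 6" using u by (auto simp: x_def)
    have "0 < sin x" using x by (intro sin_gt_zero) auto
    moreover have "sin x < 1"
      using x sin_monotone_2pi[of x "pi / 2"] by simp
    ultimately have "mahler_measure2 (\<lambda>y z. complex_of_real (2 * sin x) * cis (x - pi / 2) + y + z) =
        2 / pi * integral {0..2 * sin x / 2} arcsinc"
      using x by (intro mahler_measure2_const_add_add) auto
    moreover have "1 - cis (2 * pi * u * (1 / 6)) = complex_of_real (2 * sin x) * cis (x - pi / 2)"
      unfolding one_minus_cis_double[symmetric] by (simp add: x_def)
    ultimately show "mahler_measure2 (\<lambda>y z. 1 - cis (2 * pi * u * (1 / 6)) + y + z) = 2 / pi * ?A u"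
      by (simp add: x_def)
  qed auto
  also have "\<dots> = 2 / pi * (integral {0..1/2} arcsinc
      - 6 / pi * integral {0..1/2} (\<lambda>s. arcsin s * arcsinc s))"
    using has_integral_integral_arcsinc_sin by (simp add: integral_unique)
  also have "integral {0..1/2} arcsinc = (LBINT u:{0..1/2}. arcsin u / u)"
    by (rule set_lebesgue_integral_eq_integral_except_countable[where N="{0}", symmetric, OF c])
      (auto simp: arcsinc_def)
  also have "integral {0..1/2} (\<lambda>s. arcsin s * arcsinc s) = S_fun (1 / 2) (1 / 2)"
  proof -
    \<comment> \<open>The substitution \<open>s = x / 2\<close> leaves \<open>dx / x\<close>
      unchanged. No point is excepted: at 0 both integrands are 0, owing to the factor
      \<open>arcsin 0\<close>.\<close>
    have "continuous_on {0..1} (\<lambda>x. arcsin (x / 2) * arcsinc (x / 2) / 2)"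
      by (intro continuous_intros continuous_on_compose2[OF continuous_on_arcsinc]) auto
    then have "S_fun (1 / 2) (1 / 2) = integral {0..2 * (1/2)} (\<lambda>x. arcsin (x / 2) * arcsinc (x / 2) / 2)"
      unfolding S_fun_def
      by (subst set_lebesgue_integral_eq_integral_except_countable[where N="{}"
            and g="\<lambda>x. arcsin (x / 2) * arcsinc (x / 2) / 2"])
        (auto simp: arcsinc_def)
    also have "\<dots> = integral {0..1/2} (\<lambda>s. arcsin s * arcsinc s)"
      using integral_halve[OF cS] by simp
    finally show ?thesis by simp
  qed
  finally show ?thesis by (simp add: algebra_simps power2_eq_square)
qed

end
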